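(* Let $v(x)={}^t\!xQx$ be a positive definite quadratic form on $\mathbb{R}^n$ and let $M\subsetneq[n]$ have $m$ elements. Let $\varphi_M\colon\mathbb{R}^n\to\mathbb{R}\times\mathbb{R}^M$, $\varphi_M(x)={}^t(v(x),x^{(M)})$, let $\Phi_M=\varphi_M^{-1}(\hat\gamma_M)$, and let $\xi=(\Phi_M,\varphi_M,\hat\gamma_M)$ be the bundle defined by the map $\varphi_M$. (i) The restriction $\xi_{\mid\tilde\gamma_M}$ is a fibration with fibres $\varphi_M^{-1}({}^t(a,\tau^{(M)}))=q_{a,\tau^{(M)}}$, ${}^t(a,\tau^{(M)})\in\tilde\gamma_M$, which are ellipsoids in (the $(n-m)$-dimensional affine spaces $h(\tau^{(M)})$, identified with) $\mathbb{R}^{n-m}$ with centers $c^{(M^c)}(\tau)$. (ii) The restriction $\xi_{\mid\Gamma_M}$ is an isomorphism of real algebraic $m$-dimensional varieties with inverse isomorphism $\Gamma_M\to\mathrm{Eff}^{(M^c)}$, ${}^t(a,\tau^{(M)})\mapsto c^{(M^c)}(\tau)$, which maps any level set $\Gamma_{a,M}$ ($a\ge 0$) onto $\mathrm{Eff}^{(a;M^c)}$.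
   Context: $n\ge1$, $[n]=\{1,\dots,n\}$, $M^c=[n]\setminus M$, $Q$ is a symmetric matrix; for $x\in\mathbb{R}^n$, $x^{(M)}=(x_j)_{j\in M}$. $Q^{(M)}$ is the principal submatrix of $Q$ indexed by $M$, and $Q^{(M^c\times M)}$ is the submatrix with rows in $M^c$ and columns in $M$. $Q_a=\{x\mid v(x)=a\}$, $h(\tau^{(M)})=\{x\in\mathbb{R}^n\mid x_j=\tau_j,\ j\in M\}$, $q_{a,\tau^{(M)}}=Q_a\cap h(\tau^{(M)})$. $c^{(M^c)}(\tau)\in\mathbb{R}^n$ has $j$-th component $\tau_j$ for $j\in M$, and its components indexed by $M^c$ form the unique solution $c_{M^c}(\tau)=y$ of $Q^{(M^c)}y=-Q^{(M^c\times M)}\tau$. $\gamma_M(\tau)={}^t\tau Q^{(M)}\tau-{}^tc_{M^c}(\tau)Q^{(M^c)}c_{M^c}(\tau)$ ($\gamma_\emptyset=0$). $\hat\gamma_M=\{{}^t(a,\tau^{(M)})\in\mathbb{R}\times\mathbb{R}^M\mid a\ge\gamma_M(\tau)\}$, $\Gamma_M=\{{}^t(a,\tau^{(M)})\mid a=\gamma_M(\tau)\}$, $\tilde\gamma_M=\hat\gamma_M\setminus\Gamma_M$, and for $a\ge0$, $\Gamma_{a,M}=\{{}^t(a,\tau^{(M)})\mid a=\gamma_M(\tau)\}$ with this fixed $a$. $\mathrm{Eff}^{(M^c)}=\{c^{(M^c)}(\tau)\mid\tau\in\mathbb{R}^M\}$ (an $m$-dimensional linear subspace of $\mathbb{R}^n$),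 and $\mathrm{Eff}^{(a;M^c)}=\{c^{(M^c)}(\tau)\mid{}^t(a,\tau^{(M)})\in\Gamma_{a,M}\}$. A bundle is a triple (total space, projection map, base); its restriction to a subset $B$ of the base is the restriction of the projection to the preimage of $B$. All spaces carry the standard topology. An ellipsoid in a one-dimensional affine space is a two-point set, its center being the midpoint; in general an ellipsoid with center $c$ in $h(\tau^{(M)})$ is a set $\{x\in h(\tau^{(M)})\mid g(x-c)=\rho\}$, $g$ a positive definite quadratic form on the direction space and $\rho>0$. *)

theory Defs
  imports "HOL-Analysis.Analysis"
begin

text \<open>
  The index set $[n]$ is a finite type \<open>'n\<close>. For \<open>I :: 'n set\<close>, the space $\mathbb{R}^I$ is
  identified with the coordinate subspace of \<open>real ^ 'n\<close> of vectors supported on \<open>I\<close>; this also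
  covers \<open>I = {}\<close>. Correspondingly, restrictions of vectors and submatrices are padded by zeros.
\<close>

definition coord_space :: "'n set \<Rightarrow> (real ^ 'n) set" where
  "coord_space I = {x. \<forall>j. j \<notin> I \<longrightarrow> x $ j = 0}"

definition coord_part :: "'n set \<Rightarrow> real ^ 'n \<Rightarrow> real ^ 'n" where
  "coord_part I x = (\<chi> j. if j \<in> I then x $ j else 0)"

definition submat :: "'n set \<Rightarrow> 'n set \<Rightarrow> real ^ 'n ^ 'n \<Rightarrow> real ^ 'n ^ 'n" where
  "submat I J Q = (\<chi> i j. if i \<in> I \<and> j \<in> J then Q $ i $ j else 0)"

definition quad_form :: "real ^ 'n ^ 'n \<Rightarrow> real ^ 'n \<Rightarrow> real" where
  "quad_form Q x = x \<bullet> (Q *v x)"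

definition pos_def_form :: "real ^ 'n ^ 'n \<Rightarrow> bool" where
  "pos_def_form Q \<longleftrightarrow> transpose Q = Q \<and> (\<forall>x. x \<noteq> 0 \<longrightarrow> quad_form Q x > 0)"


section \<open>Sections of the level sets, centers and the function gamma\<close>

definition level_set :: "real ^ 'n ^ 'n \<Rightarrow> real \<Rightarrow> (real ^ 'n) set" where
  "level_set Q a = {x. quad_form Q x = a}"

definition h_space :: "'n set \<Rightarrow> real ^ 'n \<Rightarrow> (real ^ 'n) set" where
  "h_space M \<tau> = {x. \<forall>j\<in>M. x $ j = \<tau> $ j}"

definition q_section :: "real ^ 'n ^ 'n \<Rightarrow> 'n set \<Rightarrow> real \<Rightarrow> real ^ 'n \<Rightarrow> (real ^ 'n) set" where
  "q_section Q M a \<tau> = level_set Q a \<inter> h_space M \<tau>"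

definition c_sol :: "real ^ 'n ^ 'n \<Rightarrow> 'n set \<Rightarrow> real ^ 'n \<Rightarrow> real ^ 'n" where
  "c_sol Q M \<tau> =
     (THE y. y \<in> coord_space (- M) \<and> submat (- M) (- M) Q *v y = - (submat (- M) M Q *v \<tau>))"

definition c_center :: "real ^ 'n ^ 'n \<Rightarrow> 'n set \<Rightarrow> real ^ 'n \<Rightarrow> real ^ 'n" where
  "c_center Q M \<tau> = (\<chi> j. if j \<in> M then \<tau> $ j else c_sol Q M \<tau> $ j)"

definition gamma_fun :: "real ^ 'n ^ 'n \<Rightarrow> 'n set \<Rightarrow> real ^ 'n \<Rightarrow> real" where
  "gamma_fun Q M \<tau> =
     quad_form (submat M M Q) \<tau> - quad_form (submat (- M) (- M) Q) (c_sol Q M \<tau>)"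

definition gamma_hat :: "real ^ 'n ^ 'n \<Rightarrow> 'n set \<Rightarrow> (real \<times> (real ^ 'n)) set" where
  "gamma_hat Q M = {(a, \<tau>) | a \<tau>. \<tau> \<in> coord_space M \<and> a \<ge> gamma_fun Q M \<tau>}"

definition gamma_graph :: "real ^ 'n ^ 'n \<Rightarrow> 'n set \<Rightarrow> (real \<times> (real ^ 'n)) set" where
  "gamma_graph Q M = {(a, \<tau>) | a \<tau>. \<tau> \<in> coord_space M \<and> a = gamma_fun Q M \<tau>}"

definition gamma_tilde :: "real ^ 'n ^ 'n \<Rightarrow> 'n set \<Rightarrow> (real \<times> (real ^ 'n)) set" where
  "gamma_tilde Q M = gamma_hat Q M - gamma_graph Q M"

definition gamma_level :: "real ^ 'n ^ 'n \<Rightarrow> real \<Rightarrow> 'n set \<Rightarrow> (real \<times> (real ^ 'n)) set" where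
  "gamma_level Q a M = {(a, \<tau>) | \<tau>. \<tau> \<in> coord_space M \<and> a = gamma_fun Q M \<tau>}"

definition Eff :: "real ^ 'n ^ 'n \<Rightarrow> 'n set \<Rightarrow> (real ^ 'n) set" where
  "Eff Q M = {c_center Q M \<tau> | \<tau>. \<tau> \<in> coord_space M}"

definition Eff_level :: "real ^ 'n ^ 'n \<Rightarrow> real \<Rightarrow> 'n set \<Rightarrow> (real ^ 'n) set" where
  "Eff_level Q a M = {c_center Q M \<tau> | \<tau>. (a, \<tau>) \<in> gamma_level Q a M}"


section \<open>Ellipsoids\<close>

text \<open>The quadratic form is \<open>u \<mapsto> b u u\<close>; any quadratic form on the direction space of \<open>A\<close> extends
  to one on the whole space, so only positivity needs to be relativised to the direction space.\<close>

definition ellipsoid_in :: "'a::euclidean_space set \<Rightarrow> 'a \<Rightarrow> 'a set \<Rightarrow> bool" where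
  "ellipsoid_in A c S \<longleftrightarrow> affine A \<and> c \<in> A \<and>
     (\<exists>b \<rho>. bilinear b \<and> (\<forall>u. u \<in> {x - y | x y. x \<in> A \<and> y \<in> A} \<and> u \<noteq> 0 \<longrightarrow> b u u > (0::real)) \<and>
        \<rho> > 0 \<and> S = {x \<in> A. b (x - c) (x - c) = \<rho>})"


section \<open>Bundles and fibrations\<close>

text \<open>Total space and base are sets with the subspace topology.\<close>

type_synonym ('e, 'b) bundle_triple = "'e set \<times> ('e \<Rightarrow> 'b) \<times> 'b set"

fun total_space :: "('e, 'b) bundle_triple \<Rightarrow> 'e set" where
  "total_space (E, p, B) = E"

fun bundle_proj :: "('e, 'b) bundle_triple \<Rightarrow> 'e \<Rightarrow> 'b" where
  "bundle_proj (E, p, B) = p"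

fun is_bundle :: "('e::topological_space, 'b::topological_space) bundle_triple \<Rightarrow> bool" where
  "is_bundle (E, p, B) \<longleftrightarrow> continuous_on E p \<and> p ` E \<subseteq> B"

fun bundle_restrict :: "('e, 'b) bundle_triple \<Rightarrow> 'b set \<Rightarrow> ('e, 'b) bundle_triple" where
  "bundle_restrict (E, p, B) S = (E \<inter> p -` S, p, B \<inter> S)"

fun bundle_fibre :: "('e, 'b) bundle_triple \<Rightarrow> 'b \<Rightarrow> 'e set" where
  "bundle_fibre (E, p, B) b = {x \<in> E. p x = b}"

fun locally_trivial :: "('e::topological_space, 'b::topological_space) bundle_triple \<Rightarrow> bool" where
  "locally_trivial (E, p, B) \<longleftrightarrow> is_bundle (E, p, B) \<and>
     (\<forall>b\<in>B. \<exists>U. openin (top_of_set B) U \<and> b \<in> U \<and>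
        (\<exists>f g. homeomorphism (E \<inter> p -` U) (U \<times> bundle_fibre (E, p, B) b) f g \<and>
           (\<forall>x \<in> E \<inter> p -` U. fst (f x) = p x)))"

text \<open>A Hurewicz fibration has this property for every space \<open>Z\<close>. A definition cannot quantify over
  the type of the points of \<open>Z\<close>, so \<open>Z\<close> is a parameter.\<close>

fun homotopy_lifting ::
  "'z topology \<Rightarrow> ('e::topological_space, 'b::topological_space) bundle_triple \<Rightarrow> bool" where
  "homotopy_lifting Z (E, p, B) \<longleftrightarrow> is_bundle (E, p, B) \<and>
     (\<forall>k f. continuous_map (prod_topology (top_of_set {0..1::real}) Z) (top_of_set B) k \<and>
            continuous_map Z (top_of_set E) f \<and>
            (\<forall>z\<in>topspace Z. p (f z) = k (0, z)) \<longrightarrow>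
        (\<exists>K. continuous_map (prod_topology (top_of_set {0..1}) Z) (top_of_set E) K \<and>
            (\<forall>z\<in>topspace Z. K (0, z) = f z) \<and>
            (\<forall>t\<in>{0..1}. \<forall>z\<in>topspace Z. p (K (t, z)) = k (t, z))))"

definition phi_map :: "real ^ 'n ^ 'n \<Rightarrow> 'n set \<Rightarrow> real ^ 'n \<Rightarrow> real \<times> (real ^ 'n)" where
  "phi_map Q M x = (quad_form Q x, coord_part M x)"

definition xi_bundle :: "real ^ 'n ^ 'n \<Rightarrow> 'n set \<Rightarrow> (real ^ 'n, real \<times> (real ^ 'n)) bundle_triple" where
  "xi_bundle Q M = (phi_map Q M -` gamma_hat Q M, phi_map Q M, gamma_hat Q M)"


section \<open>Real algebraic varieties\<close>

text \<open>Affine real algebraic varieties are zero sets of polynomials, not necessarily irreducible;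
  morphisms are restrictions of polynomial maps.\<close>

definition algebraic_variety :: "'a::euclidean_space set \<Rightarrow> bool" where
  "algebraic_variety S \<longleftrightarrow>
     (\<exists>P. (\<forall>p\<in>P. real_polynomial_function p) \<and> S = {x. \<forall>p\<in>P. p x = 0})"

definition irreducible_variety :: "'a::euclidean_space set \<Rightarrow> bool" where
  "irreducible_variety S \<longleftrightarrow> algebraic_variety S \<and> S \<noteq> {} \<and>
     (\<forall>A B. algebraic_variety A \<and> algebraic_variety B \<and> S = A \<union> B \<longrightarrow> S = A \<or> S = B)"

definition irreducible_chain :: "'a::euclidean_space set \<Rightarrow> nat \<Rightarrow> bool" where
  "irreducible_chain S d \<longleftrightarrow>
     (\<exists>Z :: nat \<Rightarrow> 'a set. (\<forall>i\<le>d. irreducible_variety (Z i) \<and> Z i \<subseteq> S) \<and>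
        (\<forall>i<d. Z i \<subset> Z (Suc i)))"

text \<open>The dimension is the Krull dimension of the Zariski topology.\<close>

definition variety_of_dim :: "'a::euclidean_space set \<Rightarrow> nat \<Rightarrow> bool" where
  "variety_of_dim S d \<longleftrightarrow> algebraic_variety S \<and> irreducible_chain S d \<and>
     (\<forall>e. irreducible_chain S e \<longrightarrow> e \<le> d)"

definition variety_morphism ::
  "('a::euclidean_space \<Rightarrow> 'b::euclidean_space) \<Rightarrow> 'a set \<Rightarrow> 'b set \<Rightarrow> bool" where
  "variety_morphism f S T \<longleftrightarrow> f ` S \<subseteq> T \<and> (\<exists>F. polynomial_function F \<and> (\<forall>x\<in>S. f x = F x))"

definition variety_isomorphism ::
  "('a::euclidean_space \<Rightarrow> 'b::euclidean_space) \<Rightarrow> ('b \<Rightarrow> 'a) \<Rightarrow> 'a set \<Rightarrow> 'b set \<Rightarrow> bool" where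
  "variety_isomorphism f g S T \<longleftrightarrow> algebraic_variety S \<and> algebraic_variety T \<and>
     variety_morphism f S T \<and> variety_morphism g T S \<and>
     (\<forall>x\<in>S. g (f x) = x) \<and> (\<forall>y\<in>T. f (g y) = y)"

end

theory Submission
  imports Defs "HOL-Library.Function_Algebras"
begin

text \<open>
  The vector \<open>c_center Q M \<tau>\<close> is \<open>Q\<close>-orthogonal to the direction space of \<open>h_space M \<tau>\<close>, so
  \<open>v x = \<gamma> \<tau> + v (x - c \<tau>)\<close> for every \<open>x\<close> in \<open>h_space M \<tau>\<close>. Hence the fibre over \<open>(a, \<tau>)\<close> is an ellipsoid
  with center \<open>c \<tau>\<close> if \<open>a > \<gamma> \<tau>\<close> and the single point \<open>c \<tau>\<close> if \<open>a = \<gamma> \<tau>\<close>; translating and rescaling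
  \<open>x - c \<tau>\<close> carries the nondegenerate fibres onto each other and trivialises the bundle.

  The varieties over the boundary are isomorphic to a coordinate subspace of dimension \<open>m\<close>. Its
  Krull dimension is at most \<open>m\<close> because polynomials \<open>p i\<close> vanishing on the \<open>i\<close>-th but not on the next
  member of a chain of irreducible varieties are algebraically independent, and counting monomials
  shows that there are at most \<open>m\<close> algebraically independent polynomials in \<open>m\<close> variables.
\<close>

section \<open>Polynomial functions and algebraic sets\<close>

lemma polynomial_function_linear:
  fixes f :: "'a::euclidean_space \<Rightarrow> 'b::real_normed_vector"
  shows "linear f \<Longrightarrow> polynomial_function f"
  by (simp add: linear_conv_bounded_linear polynomial_function_bounded_linear)

lemma polynomial_function_compose:
  fixes g :: "'b::real_normed_vector \<Rightarrow> 'c::real_normed_vector"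
  assumes "polynomial_function f" and "polynomial_function g"
  shows "polynomial_function (g \<circ> f)"
  unfolding polynomial_function_def
proof (intro allI impI)
  fix h :: "'c \<Rightarrow> real"
  assume "bounded_linear h"
  then have "real_polynomial_function (h \<circ> g)"
    using assms(2) polynomial_function_def by blast
  then have "real_polynomial_function ((h \<circ> g) \<circ> f)"
    using assms(1) by blast
  then show "real_polynomial_function (h \<circ> (g \<circ> f))"
    by (simp add: o_assoc)
qed

text \<open>A bounded linear functional on a product splits as
  \<open>h (y, z) = h (y, 0) + h (0, z)\<close>.\<close>

lemma polynomial_function_Pair:
  fixes f :: "'a::real_normed_vector \<Rightarrow> 'b::real_normed_vector"
    and g :: "'a \<Rightarrow> 'c::real_normed_vector"
  assumes "polynomial_function f" and "polynomial_function g"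
  shows "polynomial_function (\<lambda>x. (f x, g x))"
  unfolding polynomial_function_def
proof (intro allI impI)
  fix h :: "'b \<times> 'c \<Rightarrow> real"
  assume h: "bounded_linear h"
  have "bounded_linear (\<lambda>y. h (y, 0))" "bounded_linear (\<lambda>y. h (0, y))"
    by (intro bounded_linear_compose[OF h] bounded_linear_Pair bounded_linear_ident bounded_linear_zero)+
  then have "real_polynomial_function (\<lambda>x. h (f x, 0))" "real_polynomial_function (\<lambda>x. h (0, g x))"
    using assms by (auto simp: polynomial_function_def o_def)
  then have "real_polynomial_function (\<lambda>x. h (f x, 0) + h (0, g x))"
    by (rule real_polynomial_function.intros(3))
  moreover have "h (f x, 0) + h (0, g x) = h (f x, g x)" for x
    by (simp flip: linear_add[OF bounded_linear.linear[OF h]])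
  ultimately show "real_polynomial_function (h \<circ> (\<lambda>x. (f x, g x)))"
    by (simp add: o_def)
qed

lemma algebraic_variety_Int:
  assumes "algebraic_variety S" and "algebraic_variety T"
  shows "algebraic_variety (S \<inter> T)"
proof -
  obtain P where "\<forall>p\<in>P. real_polynomial_function p" "S = {x. \<forall>p\<in>P. p x = 0}"
    using assms(1) by (auto simp: algebraic_variety_def)
  moreover obtain R where "\<forall>p\<in>R. real_polynomial_function p" "T = {x. \<forall>p\<in>R. p x = 0}"
    using assms(2) by (auto simp: algebraic_variety_def)
  ultimately show ?thesis
    unfolding algebraic_variety_def by (intro exI[of _ "P \<union> R"]) auto
qed

lemma algebraic_variety_zero_set:
  "real_polynomial_function p \<Longrightarrow> algebraic_variety {x. p x = 0}"
  unfolding algebraic_variety_def by (intro exI[of _ "{p}"]) auto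

lemma algebraic_variety_vimage:
  assumes "algebraic_variety S" and "polynomial_function f"
  shows "algebraic_variety (f -` S)"
proof -
  obtain P where P: "\<forall>p\<in>P. real_polynomial_function p" "S = {x. \<forall>p\<in>P. p x = 0}"
    using assms(1) by (auto simp: algebraic_variety_def)
  have "\<forall>p \<in> (\<lambda>p. p \<circ> f) ` P. real_polynomial_function p"
    using P assms(2) by blast
  moreover have "f -` S = {x. \<forall>p \<in> (\<lambda>p. p \<circ> f) ` P. p x = 0}"
    by (auto simp: P)
  ultimately show ?thesis
    unfolding algebraic_variety_def by blast
qed

text \<open>The origin is cut out by the coordinate functions. Preimages of it make the zero set of
  any vector-valued polynomial map algebraic.\<close>

lemma algebraic_variety_singleton_zero: "algebraic_variety {0 :: 'a :: euclidean_space}"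
  unfolding algebraic_variety_def
proof (intro exI conjI)
  show "\<forall>p\<in>(\<lambda>b x. x \<bullet> b) ` Basis. real_polynomial_function (p :: 'a \<Rightarrow> real)"
    by (auto intro!: real_polynomial_function.intros(1) bounded_linear_inner_left)
  show "{0} = {x :: 'a. \<forall>p\<in>(\<lambda>b x. x \<bullet> b) ` Basis. p x = 0}"
    by (auto simp: euclidean_all_zero_iff)
qed

lemma algebraic_variety_eq_zero:
  fixes f :: "'a::euclidean_space \<Rightarrow> 'b::euclidean_space"
  assumes "polynomial_function f"
  shows "algebraic_variety {x. f x = 0}"
  using algebraic_variety_vimage[OF algebraic_variety_singleton_zero assms] by (simp add: vimage_def)

section \<open>Invariance of irreducibility, chains and dimension under isomorphism\<close>

lemma variety_isomorphism_sym:
  "variety_isomorphism f g S T \<Longrightarrow> variety_isomorphism g f T S"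
  by (auto simp: variety_isomorphism_def)

text \<open>The image under \<open>f\<close> is the preimage under the inverse. Since
  \<open>g\<close> agrees with a polynomial map \<open>G\<close> only on \<open>T\<close>, the
  preimage under \<open>G\<close> must be cut with \<open>T\<close>.\<close>

lemma variety_isomorphism_image:
  assumes iso: "variety_isomorphism f g S T" and A: "algebraic_variety A" "A \<subseteq> S"
  shows "algebraic_variety (f ` A)"
proof -
  have fg: "\<And>x. x \<in> S \<Longrightarrow> f x \<in> T \<and> g (f x) = x" "\<And>y. y \<in> T \<Longrightarrow> g y \<in> S \<and> f (g y) = y"
    and T: "algebraic_variety T"
    using iso by (auto simp: variety_isomorphism_def variety_morphism_def)
  obtain G where G: "polynomial_function G" "\<forall>y\<in>T. g y = G y"
    using iso by (auto simp: variety_isomorphism_def variety_morphism_def)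
  have "f ` A = T \<inter> G -` A"
    using fg G(2) A(2) by (force simp: image_iff)
  then show ?thesis
    using algebraic_variety_Int[OF T algebraic_variety_vimage[OF A(1) G(1)]] by simp
qed

lemma variety_isomorphism_irreducible:
  assumes iso: "variety_isomorphism f g S T" and Z: "irreducible_variety Z" "Z \<subseteq> S"
  shows "irreducible_variety (f ` Z)"
  unfolding irreducible_variety_def
proof (intro conjI allI impI)
  have fg: "\<And>x. x \<in> S \<Longrightarrow> f x \<in> T \<and> g (f x) = x" "\<And>y. y \<in> T \<Longrightarrow> g y \<in> S \<and> f (g y) = y"
    using iso by (auto simp: variety_isomorphism_def variety_morphism_def)
  show "algebraic_variety (f ` Z)"
    using variety_isomorphism_image[OF iso] Z by (auto simp: irreducible_variety_def)
  show "f ` Z \<noteq> {}"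
    using Z by (auto simp: irreducible_variety_def)
  fix A B
  assume AB: "algebraic_variety A \<and> algebraic_variety B \<and> f ` Z = A \<union> B"
  have "f ` Z \<subseteq> T"
    using fg(1) Z(2) by blast
  then have sub: "A \<subseteq> T" "B \<subseteq> T"
    using AB by auto
  have "algebraic_variety (g ` A)" "algebraic_variety (g ` B)"
    using variety_isomorphism_image[OF variety_isomorphism_sym[OF iso]] AB sub by auto
  moreover have "Z = g ` f ` Z"
    using fg Z(2) by (force simp: image_iff)
  then have "Z = g ` A \<union> g ` B"
    using AB by (metis image_Un)
  ultimately have "Z = g ` A \<or> Z = g ` B"
    using Z(1) unfolding irreducible_variety_def by blast
  moreover have "f ` g ` A = A" "f ` g ` B = B"
    using fg sub by (force simp: image_iff)+
  ultimately show "f ` Z = A \<or> f ` Z = B"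
    by auto
qed

lemma variety_isomorphism_chain:
  assumes iso: "variety_isomorphism f g S T" and "irreducible_chain S d"
  shows "irreducible_chain T d"
proof -
  obtain Z where Z: "\<forall>i\<le>d. irreducible_variety (Z i) \<and> Z i \<subseteq> S" "\<forall>i<d. Z i \<subset> Z (Suc i)"
    using assms(2) by (auto simp: irreducible_chain_def)
  have fg: "f ` S \<subseteq> T" "inj_on f S"
    using iso by (auto simp: variety_isomorphism_def variety_morphism_def intro: inj_on_inverseI)
  have "irreducible_variety (f ` Z i) \<and> f ` Z i \<subseteq> T" if "i \<le> d" for i
    using variety_isomorphism_irreducible[OF iso] Z that fg by blast
  moreover have "f ` Z i \<subset> f ` Z (Suc i)" if "i < d" for i
  proof -
    have "Z i \<subset> Z (Suc i)" "Z (Suc i) \<subseteq> S"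
      using Z that by auto
    then show ?thesis
      using fg(2) by (metis image_strict_mono inj_on_subset)
  qed
  ultimately show ?thesis
    unfolding irreducible_chain_def by (intro exI[of _ "\<lambda>i. f ` Z i"]) auto
qed

lemma variety_isomorphism_dim:
  assumes iso: "variety_isomorphism f g S T" and "variety_of_dim S d"
  shows "variety_of_dim T d"
  using assms variety_isomorphism_chain[OF iso] variety_isomorphism_chain[OF variety_isomorphism_sym[OF iso]]
  by (auto simp: variety_of_dim_def variety_isomorphism_def)

text \<open>The zero sets of \<open>p\<close> and \<open>q\<close> cover \<open>Z\<close>, so one of
  them contains it. Algebraically: the coordinate ring of \<open>Z\<close> has no zero
  divisors.\<close>

lemma irreducible_variety_mult_eq_0:
  assumes Z: "irreducible_variety Z"
    and p: "real_polynomial_function p" and q: "real_polynomial_function q"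
    and pq: "\<And>x. x \<in> Z \<Longrightarrow> p x * q x = 0"
    and y: "y \<in> Z" "p y \<noteq> 0"
    and x: "x \<in> Z"
  shows "q x = 0"
proof -
  have "algebraic_variety (Z \<inter> {x. p x = 0})" "algebraic_variety (Z \<inter> {x. q x = 0})"
    using Z p q by (auto simp: irreducible_variety_def intro!: algebraic_variety_Int algebraic_variety_zero_set)
  moreover have "Z = (Z \<inter> {x. p x = 0}) \<union> (Z \<inter> {x. q x = 0})"
    using pq by auto
  ultimately have "Z = Z \<inter> {x. p x = 0} \<or> Z = Z \<inter> {x. q x = 0}"
    using Z unfolding irreducible_variety_def by blast
  then show ?thesis
    using x y by blast
qed


section \<open>Irreducibility of linear subspaces\<close>

lemma real_polynomial_function_on_line:
  fixes p :: "'a::real_normed_vector \<Rightarrow> real"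
  assumes "real_polynomial_function p"
  shows "\<exists>P :: real poly. \<forall>t. p (x + t *\<^sub>R v) = poly P t"
  using assms
proof induction
  case (linear f)
  show ?case
    by (intro exI[of _ "[: f x, f v :]"])
      (simp add: linear_add linear_scale bounded_linear.linear[OF linear])
next
  case (const c)
  show ?case by (intro exI[of _ "[: c :]"]) simp
next
  case (add f g)
  then show ?case by (metis poly_add)
next
  case (mult f g)
  then show ?case by (metis poly_mult)
qed

text \<open>For points \<open>x\<close> outside \<open>A\<close> and \<open>y\<close> outside
  \<open>B\<close>, polynomials separating them are restricted to the line through \<open>x\<close>
  and \<open>y\<close>, which stays in \<open>S\<close>. Their product vanishes there although
  neither factor does, which is impossible in one variable.\<close>

lemma irreducible_variety_subspace:
  fixes S :: "'a::euclidean_space set"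
  assumes S: "subspace S" and alg: "algebraic_variety S"
  shows "irreducible_variety S"
  unfolding irreducible_variety_def
proof (intro conjI allI impI alg)
  show "S \<noteq> {}"
    using S subspace_0 by blast
  fix A B
  assume AB: "algebraic_variety A \<and> algebraic_variety B \<and> S = A \<union> B"
  show "S = A \<or> S = B"
  proof (rule ccontr)
    assume "\<not> (S = A \<or> S = B)"
    then obtain x y where xy: "x \<in> S" "x \<notin> A" "y \<in> S" "y \<notin> B"
      using AB by auto
    obtain p where p: "real_polynomial_function p" "p x \<noteq> 0" "\<forall>z\<in>A. p z = 0"
      using AB xy(2) by (auto simp: algebraic_variety_def)
    obtain q where q: "real_polynomial_function q" "q y \<noteq> 0" "\<forall>z\<in>B. q z = 0"
      using AB xy(4) by (auto simp: algebraic_variety_def)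
    obtain P where P: "\<And>t. p (x + t *\<^sub>R (y - x)) = poly P t"
      using real_polynomial_function_on_line[OF p(1)] by blast
    obtain R where R: "\<And>t. q (x + t *\<^sub>R (y - x)) = poly R t"
      using real_polynomial_function_on_line[OF q(1)] by blast
    have "poly (P * R) t = 0" for t
    proof -
      have "x + t *\<^sub>R (y - x) \<in> A \<union> B"
        using AB S xy by (metis subspace_add subspace_diff subspace_scale)
      then show ?thesis
        using p(3) q(3) P[of t] R[of t] by auto
    qed
    then have "P * R = 0"
      using poly_all_0_iff_0 by blast
    \<comment> \<open>The parameters 0 and 1 correspond to the points \<open>x\<close> and
      \<open>y\<close>.\<close>
    moreover have "poly P 0 \<noteq> 0" "poly R 1 \<noteq> 0"
      using P[of 0] R[of 1] p(2) q(2) by auto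
    ultimately show False
      by auto
  qed
qed


section \<open>Chains of irreducible varieties in a coordinate subspace\<close>

text \<open>Exponents are listed from the highest index down: a list of length \<open>e\<close> uses
  exactly \<open>p 0\<close> to \<open>p (e - 1)\<close>, and prefixing an exponent introduces the
  factor \<open>p e\<close>. This suits an induction that climbs the chain.\<close>

fun power_product :: "(nat \<Rightarrow> 'a \<Rightarrow> real) \<Rightarrow> nat list \<Rightarrow> 'a \<Rightarrow> real" where
  "power_product p [] x = 1"
| "power_product p (k # ks) x = p (length ks) x ^ k * power_product p ks x"

abbreviation exponents :: "nat \<Rightarrow> nat \<Rightarrow> nat list set" where
  "exponents N e \<equiv> {ks. set ks \<subseteq> {..<N} \<and> length ks = e}"

lemma sum_exponents_Suc:
  "(\<Sum>ks\<in>exponents N (Suc e). f ks) = (\<Sum>k<N. \<Sum>ks\<in>exponents N e. f (k # ks))"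
proof -
  have "bij_betw (\<lambda>(k, ks). k # ks) ({..<N} \<times> exponents N e) (exponents N (Suc e))"
    by (intro bij_betw_byWitness[where f' = "\<lambda>l. (hd l, tl l)"])
      (auto simp: length_Suc_conv)
  then have "sum f (exponents N (Suc e)) = (\<Sum>(k, ks)\<in>{..<N} \<times> exponents N e. f (k # ks))"
    by (simp add: sum.reindex_bij_betw[symmetric] case_prod_beta)
  then show ?thesis
    by (simp add: sum.cartesian_product)
qed

lemma real_polynomial_function_power_product:
  assumes "\<And>i. i < length ks \<Longrightarrow> real_polynomial_function (p i)"
  shows "real_polynomial_function (power_product p ks)"
  using assms
proof (induction ks)
  case Nil
  have "power_product p [] = (\<lambda>x. 1)"
    by auto
  then show ?case
    by (simp only: real_polynomial_function.intros(2))
next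
  case (Cons k ks)
  then have "real_polynomial_function (\<lambda>x. p (length ks) x ^ k * power_product p ks x)"
    by (intro real_polynomial_function.intros(4) real_polynomial_function_power) auto
  moreover have "power_product p (k # ks) = (\<lambda>x. p (length ks) x ^ k * power_product p ks x)"
    by auto
  ultimately show ?case
    by (simp only:)
qed

text \<open>The functions \<open>p 0, \<dots>, p (e - 1)\<close> are algebraically independent on \<open>Z e\<close>: a relation on
  \<open>Z (Suc e)\<close> may be divided by powers of \<open>p e\<close> and then restricted to \<open>Z e\<close>, where \<open>p e\<close> vanishes.\<close>

lemma power_product_independent:
  fixes Z :: "nat \<Rightarrow> 'a::euclidean_space set" and c :: "nat list \<Rightarrow> real"
  assumes "\<And>i. i \<le> e \<Longrightarrow> irreducible_variety (Z i)"
    and "\<And>i. i < e \<Longrightarrow> Z i \<subseteq> Z (Suc i)"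
    and "\<And>i. i < e \<Longrightarrow> real_polynomial_function (p i)"
    and "\<And>i x. i < e \<Longrightarrow> x \<in> Z i \<Longrightarrow> p i x = 0"
    and "\<And>i. i < e \<Longrightarrow> \<exists>x\<in>Z (Suc i). p i x \<noteq> 0"
    and "\<And>x. x \<in> Z e \<Longrightarrow> (\<Sum>ks\<in>exponents N e. c ks * power_product p ks x) = 0"
    and "ks \<in> exponents N e"
  shows "c ks = 0"
  using assms
proof (induction e arbitrary: c ks)
  case 0
  then obtain x where "x \<in> Z 0"
    by (auto simp: irreducible_variety_def)
  moreover have "exponents N 0 = {[]}"
    by auto
  ultimately show ?case
    using "0.prems"(6)[of x] "0.prems"(7) by simp
next
  case (Suc e)
  \<comment> \<open>\<open>G k\<close> is the coefficient of the \<open>k\<close>-th power of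
    \<open>p e\<close> when the relation is sorted by powers of \<open>p e\<close>.\<close>
  define G where "G k x = (\<Sum>ks\<in>exponents N e. c (k # ks) * power_product p ks x)" for k x
  have poly_G: "real_polynomial_function (G k)" for k
    unfolding G_def
    by (intro real_polynomial_function_sum real_polynomial_function.intros(4)
        real_polynomial_function.intros(2) real_polynomial_function_power_product)
      (use Suc.prems(3) in \<open>auto simp: finite_lists_length_eq\<close>)
  have rel: "(\<Sum>k<N. p e x ^ k * G k x) = 0" if "x \<in> Z (Suc e)" for x
    unfolding Suc.prems(6)[OF that, symmetric] sum_exponents_Suc G_def sum_distrib_left
    by (intro sum.cong) auto
  \<comment> \<open>The coefficients are eliminated from the lowest power upwards.\<close>
  have coeff: "\<forall>ks\<in>exponents N e. c (k # ks) = 0" if "k < N" for k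
    using that
  proof (induction k rule: less_induct)
    case (less k)
    \<comment> \<open>What remains of the relation after its lower terms are gone and
      \<open>p e x ^ k\<close> is divided out.\<close>
    define H where "H x = (\<Sum>j\<in>{k..<N}. p e x ^ (j - k) * G j x)" for x
    have "p e x ^ k * H x = 0" if "x \<in> Z (Suc e)" for x
    proof -
      have "G j x = 0" if "j < k" for j
        using less.IH[OF that] less.prems that by (simp add: G_def)
      then have "(\<Sum>j<N. p e x ^ j * G j x) = (\<Sum>j\<in>{k..<N}. p e x ^ j * G j x)"
        by (intro sum.mono_neutral_right) auto
      also have "\<dots> = p e x ^ k * H x"
        unfolding H_def sum_distrib_left
        by (intro sum.cong) (auto simp: mult.assoc[symmetric] simp flip: power_add)
      finally show ?thesis
        using rel[OF that] by simp
    qed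
    moreover have "real_polynomial_function (\<lambda>x. p e x ^ k)" "real_polynomial_function H"
      unfolding H_def using Suc.prems(3) poly_G
      by (auto intro!: real_polynomial_function_sum real_polynomial_function.intros(4)
          real_polynomial_function_power)
    moreover obtain y where "y \<in> Z (Suc e)" "p e y \<noteq> 0"
      using Suc.prems(5)[of e] by auto
    ultimately have H0: "H x = 0" if "x \<in> Z (Suc e)" for x
      using irreducible_variety_mult_eq_0[OF Suc.prems(1)[OF order_refl], of "\<lambda>x. p e x ^ k" H y x] that
      by auto
    have "G k x = 0" if "x \<in> Z e" for x
    proof -
      have "x \<in> Z (Suc e)" "p e x = 0"
        using that Suc.prems(2,4)[of e] by auto
      \<comment> \<open>Since \<open>p e x = 0\<close>, only the term with exponent
        \<open>j - k = 0\<close> survives, by \<open>0 ^ 0 = 1\<close>.\<close>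
      then have "0 = (\<Sum>j\<in>{k..<N}. if j = k then G k x else 0)"
        using H0 unfolding H_def by (intro trans[OF H0[unfolded H_def, symmetric] sum.cong]) (auto simp: power_0_left)
      then show ?thesis
        using less.prems by simp
    qed
    then show ?case
      unfolding G_def using Suc.prems by (intro ballI Suc.IH[where c = "\<lambda>ks. c (k # ks)"]) auto
  qed
  obtain k ks' where "ks = k # ks'" "k < N" "ks' \<in> exponents N e"
    using Suc.prems(7) by (auto simp: length_Suc_conv)
  then show ?case
    using coeff by blast
qed

section \<open>Linear algebra in the space of real functions\<close>

interpretation real_fun: vector_space "\<lambda>(c :: real) (f :: 'a \<Rightarrow> real) x. c * f x"
  by standard (auto simp: fun_eq_iff algebra_simps)

lemma sum_fun_apply: "(\<Sum>i\<in>I. f i) x = (\<Sum>i\<in>I. f i x)"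
  by (induction I rule: infinite_finite_induct) auto

text \<open>This carries the exchange bound from sets to indexed families: independence of the
  family rules out repeated members, so passing to its image loses no cardinality.\<close>

lemma real_fun_independent_family_bound:
  fixes u :: "'i \<Rightarrow> 'a \<Rightarrow> real"
  assumes I: "finite I" and T: "finite T" and span: "u ` I \<subseteq> real_fun.span T"
    and ind: "\<And>c. (\<And>x. (\<Sum>i\<in>I. c i * u i x) = 0) \<Longrightarrow> \<forall>i\<in>I. c i = (0 :: real)"
  shows "card I \<le> card T"
proof -
  have inj: "inj_on u I"
  proof (rule inj_onI, rule ccontr)
    fix i j assume ij: "i \<in> I" "j \<in> I" "u i = u j" "i \<noteq> j"
    \<comment> \<open>A repeated member would give the nontrivial relation
      \<open>u i - u j = 0\<close>.\<close>
    define c where "c k = (if k = i then 1 else 0) - (if k = j then 1 else 0 :: real)" for k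
    have "(\<Sum>k\<in>I. c k * u k x) = 0" for x
      using ij I by (simp add: c_def left_diff_distrib sum_subtractf if_distrib[of "\<lambda>t. t * _"] cong: if_cong)
    then have "c i = 0"
      using ind ij(1) by blast
    then show False
      using ij(4) by (simp add: c_def)
  qed
  have "real_fun.independent (u ` I)"
  proof (rule real_fun.independent_if_scalars_zero)
    fix f y
    assume f: "(\<Sum>v\<in>u ` I. (\<lambda>x. f v * v x)) = 0" and y: "y \<in> u ` I"
    have "(\<Sum>i\<in>I. f (u i) * u i x) = 0" for x
      using fun_cong[OF f, of x] by (simp add: sum.reindex[OF inj] sum_fun_apply)
    then show "f y = 0"
      using ind[of "\<lambda>i. f (u i)"] y by auto
  qed (use I in simp)
  then have "card (u ` I) \<le> card T"
    using real_fun.independent_span_bound[OF T _ span] by blast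
  then show ?thesis
    by (simp add: card_image[OF inj])
qed

section \<open>Monomials and the polynomials they span\<close>

definition monomial :: "'n set \<Rightarrow> ('n \<Rightarrow> nat) \<Rightarrow> real ^ 'n \<Rightarrow> real" where
  "monomial M \<beta> x = (\<Prod>j\<in>M. x $ j ^ \<beta> j)"

text \<open>Bounding each exponent separately, rather than the total degree, makes the count a plain
  power of \<open>D + 1\<close>.\<close>

definition monomials :: "'n set \<Rightarrow> nat \<Rightarrow> (real ^ 'n \<Rightarrow> real) set" where
  "monomials M D = monomial M ` {\<beta>. \<forall>j\<in>M. \<beta> j \<le> D}"

text \<open>Exponents outside \<open>M\<close> are irrelevant, so they can be frozen to obtain a
  finite index set.\<close>

lemma monomials_eq: "monomials M D = monomial M ` (M \<rightarrow>\<^sub>E {..D})"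
proof -
  have "monomial M \<beta> \<in> monomial M ` (M \<rightarrow>\<^sub>E {..D})" if "\<forall>j\<in>M. \<beta> j \<le> D" for \<beta>
  proof (rule image_eqI)
    show "monomial M \<beta> = monomial M (restrict \<beta> M)"
      by (simp add: monomial_def fun_eq_iff)
    show "restrict \<beta> M \<in> M \<rightarrow>\<^sub>E {..D}"
      using that by auto
  qed
  then show ?thesis
    by (auto simp: monomials_def PiE_def Pi_def)
qed

lemma finite_monomials: "finite (monomials M D)"
  unfolding monomials_eq by (intro finite_imageI finite_PiE) auto

lemma card_monomials: "card (monomials (M :: 'n::finite set) D) \<le> (D + 1) ^ card M"
proof -
  have "card (monomials M D) \<le> card (M \<rightarrow>\<^sub>E {..D})"
    unfolding monomials_eq by (intro card_image_le finite_PiE) auto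
  then show ?thesis
    by (simp add: card_PiE)
qed

lemma monomials_mono: "D \<le> D' \<Longrightarrow> monomials M D \<subseteq> monomials M D'"
  by (force simp: monomials_def)

text \<open>Multiplying monomials adds exponents; two nested span inductions extend this
  bilinearly.\<close>

lemma span_monomials_mult:
  assumes f: "f \<in> real_fun.span (monomials M D)" and g: "g \<in> real_fun.span (monomials M D')"
  shows "(\<lambda>x. f x * g x) \<in> real_fun.span (monomials M (D + D'))"
  using f
proof (induction rule: real_fun.span_induct_alt)
  case base
  show ?case
    using real_fun.span_zero by (simp add: zero_fun_def)
next
  case (step c a y)
  have "(\<lambda>x. a x * g x) \<in> real_fun.span (monomials M (D + D'))"
    using g
  proof (induction rule: real_fun.span_induct_alt)
    case base
    show ?case
      using real_fun.span_zero by (simp add: zero_fun_def)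
  next
    case (step d b z)
    obtain \<beta> \<beta>' where "a = monomial M \<beta>" "\<forall>j\<in>M. \<beta> j \<le> D" "b = monomial M \<beta>'" "\<forall>j\<in>M. \<beta>' j \<le> D'"
      using step(1) \<open>a \<in> monomials M D\<close> by (auto simp: monomials_def)
    then have "(\<lambda>x. a x * b x) = monomial M (\<lambda>j. \<beta> j + \<beta>' j)" "\<forall>j\<in>M. \<beta> j + \<beta>' j \<le> D + D'"
      by (auto simp: monomial_def fun_eq_iff power_add prod.distrib intro: add_mono)
    then have "(\<lambda>x. a x * b x) \<in> monomials M (D + D')"
      by (auto simp: monomials_def)
    then have "(\<lambda>x. d * (a x * b x)) + (\<lambda>x. a x * z x) \<in> real_fun.span (monomials M (D + D'))"
      by (intro real_fun.span_add real_fun.span_scale real_fun.span_base step)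
    then show ?case
      by (simp add: plus_fun_def algebra_simps)
  qed
  then have "(\<lambda>x. c * (a x * g x)) + (\<lambda>x. y x * g x) \<in> real_fun.span (monomials M (D + D'))"
    by (intro real_fun.span_add real_fun.span_scale step)
  then show ?case
    by (simp add: plus_fun_def algebra_simps)
qed

lemma monomials_0: "monomials M 0 = {\<lambda>x. 1}"
proof -
  have "monomials M 0 = {monomial M (\<lambda>_. 0)}"
    by (auto simp: monomials_def monomial_def fun_eq_iff intro!: image_eqI[of _ _ "\<lambda>_. 0"])
  then show ?thesis
    by (simp add: monomial_def fun_eq_iff)
qed

lemma const_in_span_monomials: "(\<lambda>x. c) \<in> real_fun.span (monomials M D)"
proof -
  have "(\<lambda>x. 1) \<in> monomials M D"
    using monomials_0[of M] monomials_mono[of 0 D M] by auto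
  from real_fun.span_scale[OF real_fun.span_base[OF this], of c] show ?thesis
    by simp
qed

lemma span_monomials_power:
  assumes "f \<in> real_fun.span (monomials M D)"
  shows "(\<lambda>x. f x ^ k) \<in> real_fun.span (monomials M (k * D))"
proof (induction k)
  case 0
  show ?case
    using const_in_span_monomials[of 1] by simp
next
  case (Suc k)
  from span_monomials_mult[OF assms this] show ?case
    by simp
qed

lemma coord_in_span_monomials:
  assumes "j \<in> M"
  shows "(\<lambda>x :: real ^ 'n. x $ j) \<in> real_fun.span (monomials M 1)"
proof -
  have "monomial M (\<lambda>i. if i = j then 1 else 0) = (\<lambda>x. x $ j)"
    using assms by (auto simp: monomial_def fun_eq_iff if_distrib[of "(^) _"] prod.delta cong: if_cong)
  moreover have "monomial M (\<lambda>i. if i = j then 1 else 0) \<in> monomials M 1"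
    by (auto simp: monomials_def)
  ultimately show ?thesis
    using real_fun.span_base by metis
qed

lemma coord_part_eq_iff: "coord_part M x = x \<longleftrightarrow> x \<in> coord_space M"
  by (auto simp: coord_part_def coord_space_def vec_eq_iff)

lemma coord_part_in: "coord_part M x \<in> coord_space M"
  by (auto simp: coord_part_def coord_space_def)

lemma linear_coord_part: "linear (coord_part M)"
  by (auto simp: coord_part_def vec_eq_iff intro!: linearI)

text \<open>Precomposing with \<open>coord_part M\<close> leaves only the variables in
  \<open>M\<close>. Degree bounds combine by maximum for sums and by addition for products.\<close>

lemma real_polynomial_function_in_span_monomials:
  fixes p :: "real ^ 'n \<Rightarrow> real"
  assumes "real_polynomial_function p"
  shows "\<exists>D. (\<lambda>x. p (coord_part M x)) \<in> real_fun.span (monomials M D)"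
  using assms
proof induction
  case (linear f)
  have "f (coord_part M x) = (\<Sum>j\<in>M. f (axis j 1) * x $ j)" for x
  proof -
    have "coord_part M x = (\<Sum>j\<in>M. x $ j *\<^sub>R axis j 1)"
      by (simp add: vec_eq_iff coord_part_def axis_def if_distrib cong: if_cong)
    then show ?thesis
      using bounded_linear.linear[OF linear] by (simp add: linear_sum linear_scale mult.commute)
  qed
  then have "(\<lambda>x. f (coord_part M x)) = (\<Sum>j\<in>M. (\<lambda>x. f (axis j 1) * x $ j))"
    by (simp add: fun_eq_iff sum_fun_apply)
  moreover have "\<dots> \<in> real_fun.span (monomials M 1)"
    by (intro real_fun.span_sum real_fun.span_scale coord_in_span_monomials)
  ultimately show ?case
    by (metis (no_types))
next
  case (const c)
  show ?case
    using const_in_span_monomials by blast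
next
  case (add f g)
  then obtain D D' where "(\<lambda>x. f (coord_part M x)) \<in> real_fun.span (monomials M D)"
      "(\<lambda>x. g (coord_part M x)) \<in> real_fun.span (monomials M D')"
    by blast
  then have "(\<lambda>x. f (coord_part M x)) \<in> real_fun.span (monomials M (max D D'))"
      "(\<lambda>x. g (coord_part M x)) \<in> real_fun.span (monomials M (max D D'))"
    using real_fun.span_mono[OF monomials_mono] by (blast intro: max.cobounded1 max.cobounded2)+
  from real_fun.span_add[OF this] show ?case
    by (auto simp: plus_fun_def)
next
  case (mult f g)
  then show ?case
    using span_monomials_mult by blast
qed

text \<open>Each of the \<open>length ks\<close> factors is a power with exponent below
  \<open>N\<close>, hence has degree at most \<open>N * D\<close> in every variable.\<close>

lemma power_product_in_span_monomials:
  assumes "\<And>i. i < length ks \<Longrightarrow> (\<lambda>x. p i (coord_part M x)) \<in> real_fun.span (monomials M D)"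
    and "set ks \<subseteq> {..<N}"
  shows "(\<lambda>x. power_product p ks (coord_part M x)) \<in> real_fun.span (monomials M (length ks * (N * D)))"
  using assms
proof (induction ks)
  case Nil
  show ?case
    using const_in_span_monomials by simp
next
  case (Cons k ks)
  have "(\<lambda>x. p (length ks) (coord_part M x) ^ k) \<in> real_fun.span (monomials M (k * D))"
    using Cons.prems(1)[of "length ks"] by (intro span_monomials_power) simp
  also have "\<dots> \<subseteq> real_fun.span (monomials M (N * D))"
    using Cons.prems(2) by (intro real_fun.span_mono monomials_mono mult_right_mono) auto
  finally have "(\<lambda>x. p (length ks) (coord_part M x) ^ k) \<in> real_fun.span (monomials M (N * D))" .
  moreover have "(\<lambda>x. power_product p ks (coord_part M x)) \<in> real_fun.span (monomials M (length ks * (N * D)))"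
    using Cons.prems by (intro Cons.IH) auto
  ultimately show ?case
    using span_monomials_mult by fastforce
qed

text \<open>Products of powers \<open>< N\<close> of \<open>card M + 1\<close> algebraically independent polynomials would be
  \<open>N ^ (card M + 1)\<close> independent elements of a space of dimension \<open>O (N ^ card M)\<close>.\<close>

lemma irreducible_chain_coord_space_le:
  fixes M :: "'n::finite set"
  assumes "irreducible_chain (coord_space M) e"
  shows "e \<le> card M"
proof (rule ccontr)
  assume "\<not> e \<le> card M"
  \<comment> \<open>The chain is cut to one step more than \<open>card M\<close>; this single extra
    factor \<open>N\<close> yields the contradiction.\<close>
  define e' where "e' = card M + 1"
  have e': "e' \<le> e"
    using \<open>\<not> e \<le> card M\<close> by (simp add: e'_def)
  obtain Z where Z: "\<And>i. i \<le> e \<Longrightarrow> irreducible_variety (Z i)" "\<And>i. i \<le> e \<Longrightarrow> Z i \<subseteq> coord_space M"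
      "\<And>i. i < e \<Longrightarrow> Z i \<subset> Z (Suc i)"
    using assms by (auto simp: irreducible_chain_def)
  have "\<exists>p. real_polynomial_function p \<and> (\<forall>x\<in>Z i. p x = 0) \<and> (\<exists>x\<in>Z (Suc i). p x \<noteq> 0)" if i: "i < e" for i
  proof -
    obtain P where P: "\<forall>p\<in>P. real_polynomial_function p" "Z i = {x. \<forall>p\<in>P. p x = 0}"
      using Z(1)[OF less_imp_le[OF i]] unfolding irreducible_variety_def algebraic_variety_def[of "Z i"] by auto
    obtain x where "x \<in> Z (Suc i)" "x \<notin> Z i"
      using Z(3)[OF i] by auto
    then show ?thesis
      using P by auto
  qed
  then obtain p where p: "\<And>i. i < e \<Longrightarrow> real_polynomial_function (p i)"
      "\<And>i x. i < e \<Longrightarrow> x \<in> Z i \<Longrightarrow> p i x = 0" "\<And>i. i < e \<Longrightarrow> \<exists>x\<in>Z (Suc i). p i x \<noteq> 0"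
    by metis
  have "\<exists>D. (\<lambda>x. p i (coord_part M x)) \<in> real_fun.span (monomials M D)" if "i < e'" for i
    using real_polynomial_function_in_span_monomials[OF p(1)] that e' by simp
  then obtain d where d: "\<And>i. i < e' \<Longrightarrow> (\<lambda>x. p i (coord_part M x)) \<in> real_fun.span (monomials M (d i))"
    by metis
  \<comment> \<open>The sum serves as a common degree bound.\<close>
  define D where "D = (\<Sum>i<e'. d i)"
  have D: "(\<lambda>x. p i (coord_part M x)) \<in> real_fun.span (monomials M D)" if "i < e'" for i
  proof -
    have "d i \<le> D"
      unfolding D_def using that by (intro member_le_sum) auto
    then show ?thesis
      using d[OF that] real_fun.span_mono[OF monomials_mono] by blast
  qed
  \<comment> \<open>\<open>K\<close> gives \<open>e' * (N * D) + 1 \<le> N * K\<close>, and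
    \<open>N\<close> is chosen larger than \<open>K ^ card M\<close> so that
    \<open>(N * K) ^ card M < N ^ e'\<close>.\<close>
  define K where "K = e' * D + 1"
  define N where "N = K ^ card M + 1"
  have "card (exponents N e') \<le> card (monomials M (e' * (N * D)))"
  proof (rule real_fun_independent_family_bound[where u = "\<lambda>ks x. power_product p ks (coord_part M x)"])
    show "finite (exponents N e')" "finite (monomials M (e' * (N * D)))"
      by (auto simp: finite_lists_length_eq finite_monomials)
    show "(\<lambda>ks x. power_product p ks (coord_part M x)) ` exponents N e'
        \<subseteq> real_fun.span (monomials M (e' * (N * D)))"
      using power_product_in_span_monomials[of _ p M D N] D by auto
    fix c :: "nat list \<Rightarrow> real"
    assume c: "\<And>x. (\<Sum>ks\<in>exponents N e'. c ks * power_product p ks (coord_part M x)) = 0"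
    show "\<forall>ks\<in>exponents N e'. c ks = 0"
    proof
      fix ks
      assume ks: "ks \<in> exponents N e'"
      have "(\<Sum>ks\<in>exponents N e'. c ks * power_product p ks x) = 0" if "x \<in> Z e'" for x
      proof -
        have "coord_part M x = x"
          using Z(2)[OF e'] that by (auto simp: coord_part_eq_iff)
        then show ?thesis
          using c[of x] by simp
      qed
      note rel = this
      show "c ks = 0"
      proof (rule power_product_independent[where e = e' and Z = Z and p = p, OF _ _ _ _ _ rel ks])
        fix i
        show "irreducible_variety (Z i)" if "i \<le> e'"
          by (rule Z(1)) (use that e' in linarith)
        assume "i < e'"
        then have i: "i < e"
          using e' by linarith
        show "Z i \<subseteq> Z (Suc i)"
          using Z(3)[OF i] by blast
        show "real_polynomial_function (p i)" "\<exists>x\<in>Z (Suc i). p i x \<noteq> 0"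
          by (fact p(1)[OF i] p(3)[OF i])+
        show "p i x = 0" if "x \<in> Z i" for x
          by (rule p(2)[OF i that])
      qed
    qed
  qed
  then have "N ^ e' \<le> (e' * (N * D) + 1) ^ card M"
    using card_monomials[of M "e' * (N * D)"] by (simp add: card_lists_length_eq)
  also have "\<dots> \<le> (N * K) ^ card M"
    by (intro power_mono) (auto simp: K_def N_def algebra_simps)
  also have "\<dots> = N ^ card M * K ^ card M"
    by (simp add: power_mult_distrib)
  also have "\<dots> < N ^ card M * N"
    by (simp add: N_def)
  finally show False
    by (simp add: e'_def)
qed

section \<open>The dimension of a coordinate subspace\<close>

lemma subspace_coord_space: "subspace (coord_space M)"
  by (auto simp: coord_space_def subspace_def)

lemma algebraic_variety_coord_space: "algebraic_variety (coord_space M)"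
proof -
  have "polynomial_function (\<lambda>x. coord_part M x - x)"
    by (intro polynomial_function_diff polynomial_function_bounded_linear
        linear_conv_bounded_linear[THEN iffD1] linear_coord_part linear_ident)
  from algebraic_variety_eq_zero[OF this] show ?thesis
    by (simp add: coord_part_eq_iff)
qed

text \<open>The bound is attained by a flag of coordinate subspaces: an enumeration \<open>h\<close>
  of \<open>M\<close> adds one axis at a time.\<close>

lemma variety_of_dim_coord_space: "variety_of_dim (coord_space M) (card (M :: 'n::finite set))"
proof -
  obtain h where h: "bij_betw h {..<card M} M"
    using ex_bij_betw_nat_finite[of M] by (auto simp: atLeast0LessThan)
  have "coord_space (h ` {..<i}) \<subset> coord_space (h ` {..<Suc i})" if "i < card M" for i
  proof -
    have "h i \<notin> h ` {..<i}"
      using h that by (force simp: bij_betw_def inj_on_def)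
    then have "axis (h i) (1 :: real) \<notin> coord_space (h ` {..<i})"
      by (auto simp: coord_space_def axis_def)
    moreover have "axis (h i) (1 :: real) \<in> coord_space (h ` {..<Suc i})"
      by (auto simp: coord_space_def axis_def)
    moreover have "h ` {..<i} \<subseteq> h ` {..<Suc i}"
      by auto
    then have "coord_space (h ` {..<i}) \<subseteq> coord_space (h ` {..<Suc i})"
      unfolding coord_space_def by blast
    ultimately show ?thesis
      by blast
  qed
  moreover have "coord_space (h ` {..<i}) \<subseteq> coord_space M" if "i \<le> card M" for i
  proof -
    have "h ` {..<i} \<subseteq> M"
      using h that by (auto simp: bij_betw_def)
    then show ?thesis
      unfolding coord_space_def by blast
  qed
  ultimately have "irreducible_chain (coord_space M) (card M)"
    unfolding irreducible_chain_def
    by (intro exI[of _ "\<lambda>i. coord_space (h ` {..<i})"])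
      (auto intro: irreducible_variety_subspace subspace_coord_space algebraic_variety_coord_space)
  then show ?thesis
    using irreducible_chain_coord_space_le algebraic_variety_coord_space
    by (auto simp: variety_of_dim_def)
qed


section \<open>Bundles with a global parallel transport\<close>

text \<open>A transport \<open>l b x\<close> moves the point \<open>x\<close> to the fibre over \<open>b\<close>, compatibly for all base points;
  it trivialises the bundle globally and lifts homotopies.\<close>

lemma fibration_of_transport:
  fixes p :: "'e::topological_space \<Rightarrow> 'b::topological_space" and Z :: "'z topology"
  assumes bdl: "is_bundle (E, p, B)"
    and cont: "continuous_on (B \<times> E) (\<lambda>(b, x). l b x)"
    and mem: "\<And>b x. b \<in> B \<Longrightarrow> x \<in> E \<Longrightarrow> l b x \<in> E"
    and proj: "\<And>b x. b \<in> B \<Longrightarrow> x \<in> E \<Longrightarrow> p (l b x) = b"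
    and id: "\<And>x. x \<in> E \<Longrightarrow> l (p x) x = x"
    and trans: "\<And>b b' x. b \<in> B \<Longrightarrow> b' \<in> B \<Longrightarrow> x \<in> E \<Longrightarrow> l b (l b' x) = l b x"
  shows "locally_trivial (E, p, B)" and "homotopy_lifting Z (E, p, B)"
proof -
  have p: "continuous_on E p" "\<And>x. x \<in> E \<Longrightarrow> p x \<in> B"
    using bdl by auto
  show "locally_trivial (E, p, B)"
    unfolding locally_trivial.simps
  proof (intro conjI bdl ballI)
    fix b assume b: "b \<in> B"
    define F where "F = bundle_fibre (E, p, B) b"
    have F: "F \<subseteq> E" "\<And>y. y \<in> F \<Longrightarrow> p y = b"
      by (auto simp: F_def)
    \<comment> \<open>The fibre coordinate of \<open>x\<close> is its transport to the fibre over
      \<open>b\<close>; transporting back to \<open>p x\<close> recovers \<open>x\<close> by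
      \<open>trans\<close> and \<open>id\<close>.\<close>
    have "homeomorphism E (B \<times> F) (\<lambda>x. (p x, l b x)) (\<lambda>(b, x). l b x)"
    proof (rule homeomorphismI)
      have "continuous_on E ((\<lambda>(b, x). l b x) \<circ> (\<lambda>x. (b, x)))"
        by (intro continuous_on_compose continuous_on_subset[OF cont] continuous_intros) (use b in auto)
      then show "continuous_on E (\<lambda>x. (p x, l b x))"
        by (intro continuous_on_Pair p) (simp add: o_def)
      show "continuous_on (B \<times> F) (\<lambda>(b, x). l b x)"
        by (rule continuous_on_subset[OF cont]) (use F in auto)
      show "(\<lambda>x. (p x, l b x)) ` E \<subseteq> B \<times> F"
        using p b mem proj by (auto simp: F_def)
      show "(\<lambda>(b, x). l b x) ` (B \<times> F) \<subseteq> E"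
        using F mem by auto
      show "(\<lambda>(b, x). l b x) (p x, l b x) = x" if "x \<in> E" for x
        using that b p id trans by simp
      show "(\<lambda>x. (p x, l b x)) ((\<lambda>(b, x). l b x) y) = y" if "y \<in> B \<times> F" for y
        using that F b proj trans id by force
    qed
    moreover have "E \<inter> p -` B = E"
      using p by auto
    ultimately show "\<exists>U. openin (top_of_set B) U \<and> b \<in> U \<and>
        (\<exists>f g. homeomorphism (E \<inter> p -` U) (U \<times> bundle_fibre (E, p, B) b) f g \<and>
           (\<forall>x \<in> E \<inter> p -` U. fst (f x) = p x))"
      unfolding F_def by (intro exI[of _ B] conjI exI[of _ "\<lambda>x. (p x, l b x)"] exI) (use b in auto)
  qed
  show "homotopy_lifting Z (E, p, B)"
    unfolding homotopy_lifting.simps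
  proof (intro conjI bdl allI impI, elim conjE)
    fix k f
    assume k: "continuous_map (prod_topology (top_of_set {0..1::real}) Z) (top_of_set B) k"
      and f: "continuous_map Z (top_of_set E) f"
      and kf: "\<forall>z\<in>topspace Z. p (f z) = k (0, z)"
    have kB: "k (t, z) \<in> B" if "t \<in> {0..1}" "z \<in> topspace Z" for t z
      using continuous_map_funspace[OF k] that by auto
    have fE: "f z \<in> E" if "z \<in> topspace Z" for z
      using continuous_map_funspace[OF f] that by auto
    \<comment> \<open>The lift always moves the initial point \<open>f z\<close> directly to the
      fibre over \<open>k (t, z)\<close>.\<close>
    let ?K = "\<lambda>(t, z). l (k (t, z)) (f z)"
    have l: "continuous_map (prod_topology (top_of_set B) (top_of_set E)) (top_of_set E) (\<lambda>(b, x). l b x)"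
      using cont mem by (auto simp: continuous_map_in_subtopology simp flip: subtopology_Times)
    have "continuous_map (prod_topology (top_of_set {0..1}) Z) (prod_topology (top_of_set B) (top_of_set E))
        (\<lambda>y. (k y, f (snd y)))"
      using continuous_map_compose[OF continuous_map_snd f]
      by (intro continuous_map_pairedI k) (simp add: o_def)
    from continuous_map_compose[OF this l]
    have "continuous_map (prod_topology (top_of_set {0..1}) Z) (top_of_set E) ?K"
      by (simp add: o_def case_prod_unfold)
    moreover have "\<forall>z\<in>topspace Z. ?K (0, z) = f z"
      using kf fE id by (metis case_prod_conv)
    moreover have "\<forall>t\<in>{0..1}. \<forall>z\<in>topspace Z. p (?K (t, z)) = k (t, z)"
      using kB fE proj by simp
    ultimately show "\<exists>K. continuous_map (prod_topology (top_of_set {0..1}) Z) (top_of_set E) K \<and>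
        (\<forall>z\<in>topspace Z. K (0, z) = f z) \<and>
        (\<forall>t\<in>{0..1}. \<forall>z\<in>topspace Z. p (K (t, z)) = k (t, z))"
      by blast
  qed
qed


section \<open>Coordinate subspaces and block matrices\<close>

lemma coord_part_coord_part: "coord_part I (coord_part I x) = coord_part I x"
  by (simp add: coord_part_eq_iff coord_part_in)

lemma coord_part_add_Compl: "coord_part I x + coord_part (- I) x = x"
  by (auto simp: coord_part_def vec_eq_iff)

lemma coord_part_eq_0_iff: "coord_part I x = 0 \<longleftrightarrow> x \<in> coord_space (- I)"
  by (auto simp: coord_part_def coord_space_def vec_eq_iff)

lemma inner_coord_part: "coord_part I x \<bullet> y = x \<bullet> coord_part I y"
  unfolding inner_vec_def coord_part_def by (intro sum.cong) auto

text \<open>Zero padding turns a submatrix into \<open>Q\<close> between two coordinate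
  projections.\<close>

lemma submat_mult: "submat I J Q *v x = coord_part I (Q *v coord_part J x)"
  by (auto simp: submat_def coord_part_def matrix_vector_mult_def vec_eq_iff intro!: sum.cong)

lemma quad_form_submat: "quad_form (submat I I Q) x = quad_form Q (coord_part I x)"
  by (simp add: quad_form_def submat_mult inner_coord_part)

lemma aff_dim_h_space:
  fixes M :: "'n::finite set"
  shows "aff_dim (h_space M \<tau>) = int CARD('n) - int (card M)"
proof -
  have "h_space M \<tau> = (+) \<tau> ` coord_space (- M)"
  proof (intro equalityI subsetI)
    fix x assume "x \<in> h_space M \<tau>"
    then have "x - \<tau> \<in> coord_space (- M)"
      by (simp add: h_space_def coord_space_def)
    then show "x \<in> (+) \<tau> ` coord_space (- M)"
      by (intro image_eqI[of _ _ "x - \<tau>"]) auto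
  qed (auto simp: h_space_def coord_space_def)
  then have "aff_dim (h_space M \<tau>) = int (dim (coord_space (- M)))"
    by (simp add: aff_dim_translation_eq aff_dim_subspace subspace_coord_space)
  also have "dim (coord_space (- M)) = card (- M)"
    using dim_substandard_cart[of "- M", where 'a = real] by (simp add: coord_space_def dim_vec_eq)
  finally show ?thesis
    by (simp add: Compl_eq_Diff_UNIV card_Diff_subset card_mono of_nat_diff)
qed


section \<open>Completing the square\<close>

locale pos_def_quad_form =
  fixes Q :: "real ^ 'n ^ 'n" and M :: "'n set"
  assumes pos_def: "pos_def_form Q"
begin

abbreviation "c \<equiv> c_center Q M"
abbreviation "\<gamma> \<equiv> gamma_fun Q M"
abbreviation "q \<equiv> quad_form Q"
abbreviation "\<phi> \<equiv> phi_map Q M"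

lemma form_sym: "x \<bullet> (Q *v y) = y \<bullet> (Q *v x)"
proof -
  have "x \<bullet> (Q *v y) = (transpose Q *v x) \<bullet> y"
    by (simp add: dot_lmul_matrix transpose_matrix_vector)
  also have "transpose Q = Q"
    using pos_def by (simp add: pos_def_form_def)
  finally show ?thesis
    by (simp add: inner_commute)
qed

lemma q_pos: "x \<noteq> 0 \<Longrightarrow> q x > 0"
  using pos_def by (simp add: pos_def_form_def)

lemma q_0 [simp]: "q 0 = 0"
  by (simp add: quad_form_def)

lemma q_nonneg: "q x \<ge> 0"
  using q_pos[of x] by (cases "x = 0") auto

lemma q_eq_0_iff: "q x = 0 \<longleftrightarrow> x = 0"
  using q_pos[of x] q_0 by force

lemma q_scale: "q (r *\<^sub>R x) = r\<^sup>2 * q x"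
  by (simp add: quad_form_def matrix_vector_mult_scaleR power2_eq_square)

lemma q_add: "q (x + y) = q x + 2 * (y \<bullet> (Q *v x)) + q y"
  using form_sym[of x y] by (simp add: quad_form_def matrix_vector_right_distrib inner_add)

text \<open>Adding the identity on the block \<open>M\<close> makes the block of the linear system invertible
  on the whole space.\<close>

lemma linear_c_sol: "linear (c_sol Q M)"
  and c_sol_in: "c_sol Q M \<tau> \<in> coord_space (- M)"
  and c_sol_eq: "coord_part (- M) (Q *v (coord_part M \<tau> + c_sol Q M \<tau>)) = 0"
proof -
  define R where "R x = coord_part (- M) (Q *v x)" for x
  have linR: "linear R"
    using linear_compose[OF matrix_vector_mul_linear[of Q] linear_coord_part[of "- M"]]
    by (simp add: R_def[abs_def] o_def)
  define T where "T y = R (coord_part (- M) y) + coord_part M y" for y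
  have linT: "linear T"
    using linear_compose_add[OF linear_compose[OF linear_coord_part[of "- M"] linR] linear_coord_part[of M]]
    by (simp add: T_def[abs_def] o_def)
  have "y = 0" if "T y = 0" for y
  proof -
    \<comment> \<open>Both summands are nonnegative, so \<open>T y = 0\<close> forces both blocks of
      \<open>y\<close> to vanish.\<close>
    have "y \<bullet> T y = q (coord_part (- M) y) + coord_part M y \<bullet> coord_part M y"
      unfolding T_def R_def inner_add_right quad_form_def
      by (metis coord_part_coord_part inner_coord_part)
    then have "q (coord_part (- M) y) + coord_part M y \<bullet> coord_part M y = 0"
      using that by simp
    then have "q (coord_part (- M) y) = 0" "coord_part M y = 0"
      using q_nonneg[of "coord_part (- M) y"] inner_ge_zero[of "coord_part M y"]
      by (simp_all add: add_nonneg_eq_0_iff)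
    then show "y = 0"
      using coord_part_add_Compl[of M y] by (simp add: q_eq_0_iff)
  qed
  then have injT: "inj T"
    using linT by (simp add: linear_injective_0)
  obtain S where S: "linear S" "\<And>x. S (T x) = x" "\<And>x. T (S x) = x"
    using linear_injective_isomorphism[OF linT injT] by blast
  define L where "L \<tau> = S (- R (coord_part M \<tau>))" for \<tau>
  have T_L: "T (L \<tau>) = - R (coord_part M \<tau>)" for \<tau>
    by (simp add: L_def S)
  have L_in: "L \<tau> \<in> coord_space (- M)" for \<tau>
  proof -
    \<comment> \<open>On the block \<open>M\<close>, \<open>T\<close> is the identity, while the
      right-hand side of the system vanishes there.\<close>
    have "coord_part M (T (L \<tau>)) = coord_part M (L \<tau>)"
      by (auto simp: T_def R_def coord_part_def vec_eq_iff)
    moreover have "coord_part M (T (L \<tau>)) = 0"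
      unfolding T_L by (auto simp: R_def coord_part_def vec_eq_iff)
    ultimately show ?thesis
      by (simp add: coord_part_eq_0_iff)
  qed
  then have "coord_part M (L \<tau>) = 0" "coord_part (- M) (L \<tau>) = L \<tau>" for \<tau>
    by (simp_all add: coord_part_eq_0_iff coord_part_eq_iff)
  then have L_eq: "R (L \<tau>) = - R (coord_part M \<tau>)" for \<tau>
    using T_L[of \<tau>] by (simp add: T_def)
  have "c_sol Q M \<tau> = L \<tau>" for \<tau>
    unfolding c_sol_def
  proof (rule the_equality)
    show "L \<tau> \<in> coord_space (- M) \<and> submat (- M) (- M) Q *v L \<tau> = - (submat (- M) M Q *v \<tau>)"
      using L_in L_eq coord_part_eq_iff[of "- M" "L \<tau>"] by (simp add: submat_mult R_def)
    fix y
    assume y: "y \<in> coord_space (- M) \<and> submat (- M) (- M) Q *v y = - (submat (- M) M Q *v \<tau>)"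
    then have "coord_part M y = 0"
      by (simp add: coord_part_eq_0_iff)
    then have "T y = T (L \<tau>)"
      unfolding T_L using y by (simp add: submat_mult T_def R_def)
    then show "y = L \<tau>"
      using injT by (simp add: inj_eq)
  qed
  then have eq: "c_sol Q M = L"
    by blast
  have "linear (\<lambda>\<tau>. S (- R (coord_part M \<tau>)))"
    using linear_compose[OF linear_compose_neg[OF linear_compose[OF linear_coord_part[of M] linR]] S(1)]
    by (simp add: o_def)
  then show "linear (c_sol Q M)"
    by (simp add: eq L_def[abs_def])
  show "c_sol Q M \<tau> \<in> coord_space (- M)"
    by (simp add: eq L_in)
  show "coord_part (- M) (Q *v (coord_part M \<tau> + c_sol Q M \<tau>)) = 0"
    using L_eq[of \<tau>] by (simp add: R_def eq matrix_vector_right_distrib linear_add[OF linear_coord_part])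
qed

lemma c_eq: "c \<tau> = coord_part M \<tau> + c_sol Q M \<tau>"
  using c_sol_in[of \<tau>] by (auto simp: c_center_def coord_part_def coord_space_def vec_eq_iff)

lemma linear_c: "linear c"
  using linear_compose_add[OF linear_coord_part[of M] linear_c_sol] by (simp flip: c_eq)

lemma coord_part_c [simp]: "coord_part M (c \<tau>) = coord_part M \<tau>"
  by (auto simp: c_center_def coord_part_def vec_eq_iff)

text \<open>The system defining \<open>c_sol\<close> sees only the \<open>M\<close>-coordinates of
  its argument. Together with \<open>coord_part_c\<close> this makes \<open>c\<close> a linear
  projection with kernel \<open>coord_space (- M)\<close>.\<close>

lemma c_coord_part [simp]: "c (coord_part M x) = c x"
proof -
  have "c_sol Q M (coord_part M x) = c_sol Q M x"
    by (simp add: c_sol_def submat_mult coord_part_coord_part)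
  then show ?thesis
    by (simp add: c_eq coord_part_coord_part)
qed

lemma c_c [simp]: "c (c x) = c x"
  by (metis c_coord_part coord_part_c)

text \<open>The part of \<open>Q *v c \<tau>\<close> outside \<open>M\<close> is the residual of the
  system that \<open>c_sol\<close> solves.\<close>

lemma c_orthogonal:
  assumes "u \<in> coord_space (- M)"
  shows "u \<bullet> (Q *v c \<tau>) = 0"
proof -
  have "coord_part (- M) (Q *v c \<tau>) = 0"
    by (simp add: c_eq c_sol_eq)
  moreover have "coord_part (- M) u = u"
    using assms by (simp add: coord_part_eq_iff)
  ultimately show ?thesis
    by (metis inner_coord_part inner_zero_right)
qed

text \<open>With \<open>c \<tau> = t + y\<close>, orthogonality makes the cross term of
  \<open>q (t + y)\<close> equal to \<open>- 2 * q y\<close>, which turns \<open>+ q y\<close> into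
  \<open>- q y\<close>.\<close>

lemma \<gamma>_eq: "\<gamma> \<tau> = q (c \<tau>)"
proof -
  define t y where "t = coord_part M \<tau>" and "y = c_sol Q M \<tau>"
  have y_in: "y \<in> coord_space (- M)"
    unfolding y_def by (rule c_sol_in)
  then have y: "coord_part (- M) y = y"
    by (simp add: coord_part_eq_iff)
  have c: "c \<tau> = t + y"
    by (simp add: c_eq t_def y_def)
  have "y \<bullet> (Q *v t) + q y = 0"
    using c_orthogonal[OF y_in, of \<tau>]
    by (simp add: c matrix_vector_right_distrib inner_add_right quad_form_def)
  then have "q (c \<tau>) = q t - q y"
    by (simp add: c q_add)
  also have "\<dots> = \<gamma> \<tau>"
    by (simp add: gamma_fun_def quad_form_submat t_def y flip: y_def)
  finally show ?thesis ..
qed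

lemma \<gamma>_coord_part [simp]: "\<gamma> (coord_part M x) = \<gamma> x"
  by (simp add: \<gamma>_eq)

lemma diff_c_in: "x - c x \<in> coord_space (- M)"
  by (simp add: linear_diff[OF linear_coord_part] flip: coord_part_eq_0_iff)

lemma complete_square: "q x = \<gamma> x + q (x - c x)"
  using q_add[of "c x" "x - c x"] c_orthogonal[OF diff_c_in] by (simp add: \<gamma>_eq)

section \<open>Interior and boundary in terms of the remainder \<open>x - c x\<close>\<close>

lemma mem_gamma_tilde: "(a, \<tau>) \<in> gamma_tilde Q M \<longleftrightarrow> \<tau> \<in> coord_space M \<and> \<gamma> \<tau> < a"
  by (auto simp: gamma_tilde_def gamma_hat_def gamma_graph_def)

lemma mem_gamma_graph: "(a, \<tau>) \<in> gamma_graph Q M \<longleftrightarrow> \<tau> \<in> coord_space M \<and> a = \<gamma> \<tau>"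
  by (auto simp: gamma_graph_def)

lemma \<phi>_in_gamma_hat: "\<phi> x \<in> gamma_hat Q M"
  using complete_square[of x] q_nonneg[of "x - c x"]
  by (simp add: phi_map_def gamma_hat_def coord_part_in)

lemma \<phi>_in_gamma_tilde: "\<phi> x \<in> gamma_tilde Q M \<longleftrightarrow> q (x - c x) > 0"
  using complete_square[of x] by (auto simp: phi_map_def mem_gamma_tilde coord_part_in)

lemma \<phi>_in_gamma_graph: "\<phi> x \<in> gamma_graph Q M \<longleftrightarrow> c x = x"
  using complete_square[of x] q_eq_0_iff[of "x - c x"]
  by (auto simp: phi_map_def mem_gamma_graph coord_part_in)

text \<open>The range of a projection is its fixed-point set, which gives polynomial equations for
  \<open>Eff\<close>.\<close>

lemma Eff_eq: "Eff Q M = {x. c x = x}"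
proof -
  have "\<exists>\<tau>. x = c \<tau> \<and> \<tau> \<in> coord_space M" if "c x = x" for x
    using that coord_part_in[of M x] c_coord_part[of x] by metis
  then show ?thesis
    by (auto simp: Eff_def)
qed

lemma restrict_xi_tilde:
  "bundle_restrict (xi_bundle Q M) (gamma_tilde Q M) = (\<phi> -` gamma_tilde Q M, \<phi>, gamma_tilde Q M)"
  using \<phi>_in_gamma_hat by (auto simp: xi_bundle_def gamma_tilde_def)

lemma polynomial_q: "polynomial_function q"
proof -
  have "q = (\<lambda>x. \<Sum>i\<in>UNIV. x $ i * (Q *v x) $ i)"
    by (simp add: quad_form_def inner_vec_def fun_eq_iff)
  moreover have "polynomial_function (\<lambda>x. \<Sum>i\<in>UNIV. x $ i * (Q *v x) $ i)"
    unfolding real_polynomial_function_eq[symmetric]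
    by (intro real_polynomial_function_sum real_polynomial_function.intros(4)
        real_polynomial_function.intros(1) bounded_linear_vec_nth
        bounded_linear_compose[OF bounded_linear_vec_nth] matrix_vector_mul_bounded_linear) simp
  ultimately show ?thesis
    by simp
qed

lemma polynomial_\<gamma>: "polynomial_function \<gamma>"
  using polynomial_function_compose[OF polynomial_function_linear[OF linear_c] polynomial_q]
  by (simp add: \<gamma>_eq[abs_def] o_def)

lemma polynomial_\<phi>: "polynomial_function \<phi>"
  unfolding phi_map_def
  by (intro polynomial_function_Pair polynomial_q polynomial_function_linear linear_coord_part)

lemma is_bundle_xi: "is_bundle (xi_bundle Q M)"
  using continuous_on_polymonial_function[OF polynomial_\<phi>] \<phi>_in_gamma_hat by (auto simp: xi_bundle_def)


section \<open>The fibration over the interior\<close>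

text \<open>The center is replaced by that of the target fibre, and the remainder is rescaled so
  that its \<open>q\<close>-value becomes \<open>a - \<gamma> \<tau>\<close>; the root appears
  because \<open>q\<close> is quadratic.\<close>

definition transport :: "real \<times> (real ^ 'n) \<Rightarrow> real ^ 'n \<Rightarrow> real ^ 'n" where
  "transport b x = c (snd b) + sqrt ((fst b - \<gamma> (snd b)) / q (x - c x)) *\<^sub>R (x - c x)"

lemma c_transport: "c (transport b x) = c (snd b)"
  by (simp add: transport_def linear_add linear_scale linear_diff linear_c)

lemma q_transport:
  assumes "b \<in> gamma_tilde Q M" "\<phi> x \<in> gamma_tilde Q M"
  shows "q (transport b x - c (transport b x)) = fst b - \<gamma> (snd b)"
proof -
  have "fst b - \<gamma> (snd b) > 0" "q (x - c x) > 0"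
    using assms mem_gamma_tilde[of "fst b" "snd b"] by (auto simp: \<phi>_in_gamma_tilde)
  moreover have "transport b x - c (transport b x) = sqrt ((fst b - \<gamma> (snd b)) / q (x - c x)) *\<^sub>R (x - c x)"
    unfolding c_transport by (simp add: transport_def)
  ultimately show ?thesis
    by (simp add: q_scale)
qed

lemma \<phi>_transport:
  assumes "b \<in> gamma_tilde Q M" "\<phi> x \<in> gamma_tilde Q M"
  shows "\<phi> (transport b x) = b"
proof (cases b)
  case (Pair a \<tau>)
  then have "coord_part M \<tau> = \<tau>"
    using assms by (simp add: mem_gamma_tilde coord_part_eq_iff)
  then have "coord_part M (transport b x) = \<tau>"
    using coord_part_c[of "transport b x"] coord_part_c[of \<tau>] by (simp add: c_transport Pair)
  moreover have "q (transport b x) = a"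
    using complete_square[of "transport b x"] q_transport[OF assms]
    by (simp add: \<gamma>_eq c_transport Pair)
  ultimately show ?thesis
    by (simp add: phi_map_def Pair)
qed

text \<open>By \<open>complete_square\<close> the quotient under the root is 1.\<close>

lemma transport_\<phi>:
  assumes "\<phi> x \<in> gamma_tilde Q M"
  shows "transport (\<phi> x) x = x"
  using assms complete_square[of x] by (simp add: transport_def \<phi>_in_gamma_tilde) (simp add: phi_map_def)

text \<open>Scaling factors compose: the intermediate value \<open>?r'\<close> cancels.\<close>

lemma transport_transport:
  assumes "b \<in> gamma_tilde Q M" "b' \<in> gamma_tilde Q M" "\<phi> x \<in> gamma_tilde Q M"
  shows "transport b (transport b' x) = transport b x"
proof -
  let ?r = "fst b - \<gamma> (snd b)" and ?r' = "fst b' - \<gamma> (snd b')" and ?u = "x - c x"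
  have pos: "?r > 0" "?r' > 0" "q ?u > 0"
    using assms mem_gamma_tilde[of "fst b" "snd b"] mem_gamma_tilde[of "fst b'" "snd b'"]
    by (auto simp: \<phi>_in_gamma_tilde)
  have "transport b' x - c (transport b' x) = sqrt (?r' / q ?u) *\<^sub>R ?u"
    unfolding c_transport by (simp add: transport_def)
  then have "transport b (transport b' x) = c (snd b) + sqrt (?r / ?r') *\<^sub>R sqrt (?r' / q ?u) *\<^sub>R ?u"
    using q_transport[OF assms(2,3)] unfolding transport_def[of b] by simp
  also have "sqrt (?r / ?r') *\<^sub>R sqrt (?r' / q ?u) *\<^sub>R ?u = sqrt (?r / q ?u) *\<^sub>R ?u"
    using pos by (simp flip: real_sqrt_mult)
  finally show ?thesis
    by (simp add: transport_def)
qed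

text \<open>The denominator \<open>q (x - c x)\<close> is positive over the interior.\<close>

lemma continuous_transport:
  "continuous_on (gamma_tilde Q M \<times> \<phi> -` gamma_tilde Q M) (\<lambda>(b, x). transport b x)"
proof -
  have "continuous_on UNIV c" "continuous_on UNIV \<gamma>" "continuous_on UNIV q"
    by (intro continuous_on_polymonial_function polynomial_\<gamma> polynomial_q polynomial_function_linear linear_c)+
  note [continuous_intros] = this[THEN continuous_on_compose2, OF _ subset_UNIV]
  show ?thesis
    unfolding transport_def case_prod_unfold
    by (intro continuous_intros) (auto simp: \<phi>_in_gamma_tilde)
qed

lemma fibration_tilde:
  "locally_trivial (bundle_restrict (xi_bundle Q M) (gamma_tilde Q M))"
  "homotopy_lifting Z (bundle_restrict (xi_bundle Q M) (gamma_tilde Q M))"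
proof -
  have "is_bundle (\<phi> -` gamma_tilde Q M, \<phi>, gamma_tilde Q M)"
    using continuous_on_polymonial_function[OF polynomial_\<phi>] by auto
  note * = fibration_of_transport[OF this continuous_transport]
  show "locally_trivial (bundle_restrict (xi_bundle Q M) (gamma_tilde Q M))"
    unfolding restrict_xi_tilde
    by (rule *(1)) (auto simp: \<phi>_transport transport_\<phi> transport_transport)
  show "homotopy_lifting Z (bundle_restrict (xi_bundle Q M) (gamma_tilde Q M))"
    unfolding restrict_xi_tilde
    by (rule *(2)) (auto simp: \<phi>_transport transport_\<phi> transport_transport)
qed

section \<open>The fibres as ellipsoids\<close>

lemma coord_part_eq_iff_h_space:
  assumes "\<tau> \<in> coord_space M"
  shows "coord_part M x = \<tau> \<longleftrightarrow> x \<in> h_space M \<tau>"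
  using assms by (auto simp: coord_part_def coord_space_def h_space_def vec_eq_iff)

lemma fibre_eq_q_section:
  assumes "\<tau> \<in> coord_space M"
  shows "\<phi> -` {(a, \<tau>)} = q_section Q M a \<tau>"
  by (simp add: set_eq_iff phi_map_def q_section_def level_set_def coord_part_eq_iff_h_space[OF assms])

lemma ellipsoid_q_section:
  assumes "(a, \<tau>) \<in> gamma_tilde Q M"
  shows "ellipsoid_in (h_space M \<tau>) (c \<tau>) (q_section Q M a \<tau>)"
  unfolding ellipsoid_in_def
proof (intro conjI exI[of _ "\<lambda>u w. u \<bullet> (Q *v w)"] exI[of _ "a - \<gamma> \<tau>"])
  show "affine (h_space M \<tau>)"
    unfolding affine_def
  proof (intro ballI allI impI)
    fix x y and u v :: real
    assume xy: "x \<in> h_space M \<tau>" "y \<in> h_space M \<tau>" and uv: "u + v = 1"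
    have "u * \<tau> $ j + v * \<tau> $ j = \<tau> $ j" for j
      by (metis distrib_right mult_1 uv)
    then show "u *\<^sub>R x + v *\<^sub>R y \<in> h_space M \<tau>"
      using xy by (simp add: h_space_def)
  qed
  show "c \<tau> \<in> h_space M \<tau>"
    by (simp add: h_space_def c_center_def)
  show "bilinear (\<lambda>u w. u \<bullet> (Q *v w))"
    unfolding bilinear_def
    by (auto intro!: linearI simp: inner_add_left inner_add_right matrix_vector_right_distrib matrix_vector_mult_scaleR)
  show "\<forall>u. u \<in> {x - y |x y. x \<in> h_space M \<tau> \<and> y \<in> h_space M \<tau>} \<and> u \<noteq> 0 \<longrightarrow> 0 < u \<bullet> (Q *v u)"
    using q_pos by (simp add: quad_form_def)
  show "a - \<gamma> \<tau> > 0"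
    using assms by (simp add: mem_gamma_tilde)
  have \<tau>: "\<tau> \<in> coord_space M"
    using assms by (simp add: mem_gamma_tilde)
  \<comment> \<open>All points of \<open>h_space M \<tau>\<close> share the center
    \<open>c \<tau>\<close>, so the fibre equation becomes a level condition on
    \<open>x - c \<tau>\<close>.\<close>
  have "q x = \<gamma> \<tau> + q (x - c \<tau>)" if "x \<in> h_space M \<tau>" for x
  proof -
    have "coord_part M x = \<tau>"
      using that by (simp add: coord_part_eq_iff_h_space[OF \<tau>])
    then have "c x = c \<tau>" "\<gamma> x = \<gamma> \<tau>"
      by (metis c_coord_part) (metis \<gamma>_coord_part \<open>coord_part M x = \<tau>\<close>)
    then show ?thesis
      using complete_square[of x] by simp
  qed
  then show "q_section Q M a \<tau> = {x \<in> h_space M \<tau>. (x - c \<tau>) \<bullet> (Q *v (x - c \<tau>)) = a - \<gamma> \<tau>}"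
    unfolding quad_form_def[of Q "_ - _", symmetric] by (auto simp: q_section_def level_set_def)
qed


section \<open>The boundary\<close>

lemma total_space_graph: "total_space (bundle_restrict (xi_bundle Q M) (gamma_graph Q M)) = Eff Q M"
proof -
  have "total_space (bundle_restrict (xi_bundle Q M) (gamma_graph Q M)) = {x. \<phi> x \<in> gamma_graph Q M}"
    using \<phi>_in_gamma_hat by (auto simp: xi_bundle_def)
  then show ?thesis
    by (simp add: \<phi>_in_gamma_graph Eff_eq)
qed

lemma algebraic_variety_Eff: "algebraic_variety (Eff Q M)"
proof -
  have "polynomial_function (\<lambda>x. c x - x)"
    by (intro polynomial_function_diff polynomial_function_id polynomial_function_linear linear_c)
  from algebraic_variety_eq_zero[OF this] show ?thesis
    by (simp add: Eff_eq)
qed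

lemma algebraic_variety_gamma_graph: "algebraic_variety (gamma_graph Q M)"
proof -
  have lin: "linear (\<lambda>y :: real \<times> (real ^ 'n). coord_part M (snd y) - snd y)"
    using linear_compose_sub[OF linear_compose[OF linear_snd linear_coord_part[of M]] linear_snd]
    by (simp add: o_def)
  have "polynomial_function (\<lambda>y :: real \<times> (real ^ 'n). fst y - \<gamma> (snd y))"
    using polynomial_function_compose[OF polynomial_function_linear[OF linear_snd] polynomial_\<gamma>]
    by (intro polynomial_function_diff) (auto intro: polynomial_function_linear linear_fst simp: o_def)
  from polynomial_function_Pair[OF polynomial_function_linear[OF lin] this]
  have "algebraic_variety {y. (coord_part M (snd y) - snd y, fst y - \<gamma> (snd y)) = 0}"
    by (rule algebraic_variety_eq_zero)
  moreover have "{y. (coord_part M (snd y) - snd y, fst y - \<gamma> (snd y)) = 0} = gamma_graph Q M"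
    by (auto simp: zero_prod_def coord_part_eq_iff gamma_graph_def)
  ultimately show ?thesis
    by simp
qed

text \<open>On the graph, \<open>\<phi> (c \<tau>) = (\<gamma> \<tau>, \<tau>)\<close> by
  \<open>\<gamma>_eq\<close>; conversely \<open>c\<close> recovers a point of \<open>Eff\<close>
  from its \<open>M\<close>-coordinates.\<close>

lemma isomorphism_Eff_graph: "variety_isomorphism \<phi> (\<lambda>(a, \<tau>). c \<tau>) (Eff Q M) (gamma_graph Q M)"
  unfolding variety_isomorphism_def variety_morphism_def
proof (intro conjI algebraic_variety_Eff algebraic_variety_gamma_graph)
  show "\<phi> ` Eff Q M \<subseteq> gamma_graph Q M"
    by (auto simp: \<phi>_in_gamma_graph Eff_eq)
  show "(\<lambda>(a, \<tau>). c \<tau>) ` gamma_graph Q M \<subseteq> Eff Q M"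
    by (auto simp: Eff_eq)
  show "\<exists>F. polynomial_function F \<and> (\<forall>x\<in>Eff Q M. \<phi> x = F x)"
    using polynomial_\<phi> by blast
  have "polynomial_function (\<lambda>y :: real \<times> (real ^ 'n). c (snd y))"
    using polynomial_function_linear[OF linear_compose[OF linear_snd linear_c]] by (simp add: o_def)
  then show "\<exists>F. polynomial_function F \<and> (\<forall>y\<in>gamma_graph Q M. (case y of (a, \<tau>) \<Rightarrow> c \<tau>) = F y)"
    by (auto simp: case_prod_unfold)
  show "\<forall>x\<in>Eff Q M. (case \<phi> x of (a, \<tau>) \<Rightarrow> c \<tau>) = x"
    by (auto simp: Eff_eq phi_map_def)
  show "\<forall>y\<in>gamma_graph Q M. \<phi> (case y of (a, \<tau>) \<Rightarrow> c \<tau>) = y"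
    by (auto simp: phi_map_def mem_gamma_graph \<gamma>_eq coord_part_eq_iff)
qed

text \<open>This linear isomorphism transfers the dimension of \<open>coord_space M\<close> to
  \<open>Eff\<close>, and from there to the graph.\<close>

lemma isomorphism_coord_space_Eff: "variety_isomorphism c (coord_part M) (coord_space M) (Eff Q M)"
  unfolding variety_isomorphism_def variety_morphism_def
proof (intro conjI algebraic_variety_Eff algebraic_variety_coord_space)
  show "\<exists>F. polynomial_function F \<and> (\<forall>x\<in>coord_space M. c x = F x)"
    using polynomial_function_linear[OF linear_c] by blast
  show "\<exists>F. polynomial_function F \<and> (\<forall>x\<in>Eff Q M. coord_part M x = F x)"
    using polynomial_function_linear[OF linear_coord_part] by blast
qed (auto simp: Eff_eq coord_part_in coord_part_eq_iff)

lemma dim_Eff: "variety_of_dim (Eff Q M) (card M)"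
  using variety_isomorphism_dim[OF isomorphism_coord_space_Eff variety_of_dim_coord_space] .

lemma dim_gamma_graph: "variety_of_dim (gamma_graph Q M) (card M)"
  using variety_isomorphism_dim[OF isomorphism_Eff_graph dim_Eff] .

lemma image_gamma_level: "(\<lambda>(a, \<tau>). c \<tau>) ` gamma_level Q a M = Eff_level Q a M"
  by (force simp: Eff_level_def gamma_level_def image_iff)

end

theorem theorem2p3p1:
  fixes Q :: "real ^ 'n ^ 'n" and M :: "'n set" and Z :: "'z topology"
  assumes "pos_def_form Q" and "M \<subset> UNIV"
  shows "is_bundle (xi_bundle Q M)
    \<and> (locally_trivial (bundle_restrict (xi_bundle Q M) (gamma_tilde Q M))
       \<and> homotopy_lifting Z (bundle_restrict (xi_bundle Q M) (gamma_tilde Q M))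
       \<and> (\<forall>a \<tau>. (a, \<tau>) \<in> gamma_tilde Q M \<longrightarrow>
            bundle_fibre (bundle_restrict (xi_bundle Q M) (gamma_tilde Q M)) (a, \<tau>)
              = phi_map Q M -` {(a, \<tau>)}
          \<and> phi_map Q M -` {(a, \<tau>)} = q_section Q M a \<tau>
          \<and> aff_dim (h_space M \<tau>) = int CARD('n) - int (card M)
          \<and> ellipsoid_in (h_space M \<tau>) (c_center Q M \<tau>) (q_section Q M a \<tau>)))
    \<and> (total_space (bundle_restrict (xi_bundle Q M) (gamma_graph Q M)) = Eff Q M
       \<and> variety_isomorphism
            (bundle_proj (bundle_restrict (xi_bundle Q M) (gamma_graph Q M)))
            (\<lambda>(a, \<tau>). c_center Q M \<tau>) (Eff Q M) (gamma_graph Q M)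
       \<and> variety_of_dim (Eff Q M) (card M)
       \<and> variety_of_dim (gamma_graph Q M) (card M)
       \<and> (\<forall>a\<ge>0. (\<lambda>(a, \<tau>). c_center Q M \<tau>) ` gamma_level Q a M = Eff_level Q a M))"
proof -
  interpret pos_def_quad_form Q M
    by standard (rule assms(1))
  have "bundle_fibre (bundle_restrict (xi_bundle Q M) (gamma_tilde Q M)) b = \<phi> -` {b}"
    if "b \<in> gamma_tilde Q M" for b
    using that unfolding restrict_xi_tilde by auto
  moreover have "\<phi> -` {(a, \<tau>)} = q_section Q M a \<tau>" if "(a, \<tau>) \<in> gamma_tilde Q M" for a \<tau>
    using that by (simp add: fibre_eq_q_section mem_gamma_tilde)
  moreover have "bundle_proj (bundle_restrict (xi_bundle Q M) (gamma_graph Q M)) = \<phi>"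
    by (simp add: xi_bundle_def)
  ultimately show ?thesis
    using is_bundle_xi fibration_tilde(1) fibration_tilde(2)[of Z] ellipsoid_q_section aff_dim_h_space[of M] total_space_graph
      isomorphism_Eff_graph dim_Eff dim_gamma_graph image_gamma_level
    by simp
qed

end
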